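(* Let $n, d$ be positive integers and let $\mu_1, \ldots, \mu_n$ be finite absolutely continuous measures on $\mathbb{R}^d$ which are nicely separated and concentrated. Let $\alpha_1, \ldots, \alpha_n$ be real numbers in $(0,1)$. Then there exists a polytope $K$ with $n$ vertices such that $\mu_i(K) = \alpha_i \cdot \mu_i(\mathbb{R}^d)$ for every $1 \le i \le n$.
   Context: A measure $\mu$ on $\mathbb{R}^d$ with support $K$ is called absolutely continuous if it is absolutely continuous with respect to the Lebesgue measure, the interior of $K$ is nonempty and connected, and $\mu(U) > 0$ for every open set $U \subset K$. Let $K_i$ be the support of $\mu_i$. The measures are nicely separated if for each $1 \le i \le n$ there is a hyperplane $H_i$, with closed half-spaces $H_i^+, H_i^-$, such that $K_i \cap H_i^+ = \emptyset$ and $K_j \cap H_i^- = \emptyset$ for all $j \ne i$. With such hyperplanes $H_i$ and $P = \bigcap_{i=1}^n H_i^+$, the measures are concentrated if there exist a point $p \in P$ and points $p_i, q_i$ ($i = 1,\ldots,n$) such that: (1) $p_i \in H_i \cap P$ for each $i$, and writing $K_0 = \operatorname{conv}\{p_1,\ldots,p_n\}$, (2) $p \in K_0$; (3) for each $i$, $q_i$ lies on the ray from $p$ through $p_i$ and in $\bigcap_{i' \ne i} H_{i'}^+$; (4) for each $i$, $K_i \subset \operatorname{conv}(\{q_i\} \cup K_0)$. *)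

theory Defs
  imports "HOL-Analysis.Analysis"
begin

definition msupport :: "('a::topological_space) measure \<Rightarrow> 'a set" where
  "msupport M = {x. \<forall>U. open U \<longrightarrow> x \<in> U \<longrightarrow> 0 < emeasure M U}"

text \<open>For the support as defined above, the last conjunct is automatic; it is kept because it is
  part of the definition being formalized.\<close>

definition abs_cont_measure :: "('a::euclidean_space) measure \<Rightarrow> bool" where
  "abs_cont_measure M \<longleftrightarrow>
     sets M = sets borel \<and>
     absolutely_continuous lborel M \<and>
     interior (msupport M) \<noteq> {} \<and>
     connected (interior (msupport M)) \<and>
     (\<forall>U. open U \<longrightarrow> U \<noteq> {} \<longrightarrow> U \<subseteq> msupport M \<longrightarrow> 0 < emeasure M U)"

text \<open>A hyperplane with its two closed half-spaces is given by a nonzero normal vector \<open>a\<close> and an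
  offset \<open>b\<close>. Since \<open>(a, b)\<close> may be replaced by \<open>(- a, - b)\<close>, either side can be the positive one.\<close>

definition hplane :: "'a::euclidean_space \<Rightarrow> real \<Rightarrow> 'a set" where
  "hplane a b = {x. a \<bullet> x = b}"

definition hplus :: "'a::euclidean_space \<Rightarrow> real \<Rightarrow> 'a set" where
  "hplus a b = {x. b \<le> a \<bullet> x}"

definition hminus :: "'a::euclidean_space \<Rightarrow> real \<Rightarrow> 'a set" where
  "hminus a b = {x. a \<bullet> x \<le> b}"

definition ray :: "'a::euclidean_space \<Rightarrow> 'a \<Rightarrow> 'a set" where
  "ray p x = {p + t *\<^sub>R (x - p) |t. 0 \<le> t}"

definition separating_hyperplanes ::
    "nat \<Rightarrow> (nat \<Rightarrow> ('a::euclidean_space) measure) \<Rightarrow> (nat \<Rightarrow> 'a) \<Rightarrow> (nat \<Rightarrow> real) \<Rightarrow> bool" where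
  "separating_hyperplanes n \<mu> a b \<longleftrightarrow>
     (\<forall>i\<in>{1..n}. a i \<noteq> 0 \<and>
        msupport (\<mu> i) \<inter> hplus (a i) (b i) = {} \<and>
        (\<forall>j\<in>{1..n}. j \<noteq> i \<longrightarrow> msupport (\<mu> j) \<inter> hminus (a i) (b i) = {}))"

definition nicely_separated :: "nat \<Rightarrow> (nat \<Rightarrow> ('a::euclidean_space) measure) \<Rightarrow> bool" where
  "nicely_separated n \<mu> \<longleftrightarrow> (\<exists>a b. separating_hyperplanes n \<mu> a b)"

definition concentrated_wrt ::
    "nat \<Rightarrow> (nat \<Rightarrow> ('a::euclidean_space) measure) \<Rightarrow> (nat \<Rightarrow> 'a) \<Rightarrow> (nat \<Rightarrow> real) \<Rightarrow> bool" where
  "concentrated_wrt n \<mu> a b \<longleftrightarrow>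
     (let P = (\<Inter>i\<in>{1..n}. hplus (a i) (b i)) in
      \<exists>p\<in>P. \<exists>pt q :: nat \<Rightarrow> 'a.
        (let K0 = convex hull (pt ` {1..n}) in
          (\<forall>i\<in>{1..n}. pt i \<in> hplane (a i) (b i) \<inter> P) \<and>
          p \<in> K0 \<and>
          (\<forall>i\<in>{1..n}. q i \<in> ray p (pt i) \<inter> (\<Inter>j\<in>{1..n} - {i}. hplus (a j) (b j))) \<and>
          (\<forall>i\<in>{1..n}. msupport (\<mu> i) \<subseteq> convex hull ({q i} \<union> K0))))"

text \<open>Concentration refers to hyperplanes witnessing nice separation; the choice of these is part of
  the existential claim.\<close>

definition concentrated :: "nat \<Rightarrow> (nat \<Rightarrow> ('a::euclidean_space) measure) \<Rightarrow> bool" where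
  "concentrated n \<mu> \<longleftrightarrow>
     (\<exists>a b. separating_hyperplanes n \<mu> a b \<and> concentrated_wrt n \<mu> a b)"

definition vertices :: "'a::euclidean_space set \<Rightarrow> 'a set" where
  "vertices K = {v. v extreme_point_of K}"

end

theory Submission imports Defs begin

text \<open>
  Put the \<open>j\<close>-th vertex at \<open>v\<^sub>j = p + s\<^sub>j (p\<^sub>j - p)\<close> and let \<open>s\<^sub>j\<close> run from \<open>1\<close>, where the vertex is
  \<open>p\<^sub>j\<close>, to the value \<open>t\<^sub>j > 1\<close> where it is \<open>q\<^sub>j\<close>. If \<open>s\<^sub>i = 1\<close>, the convex hull of the vertices lies in
  \<open>H\<^sub>i\<^sup>+\<close> and misses \<open>K\<^sub>i\<close>; if \<open>s\<^sub>i = t\<^sub>i\<close>, it contains \<open>conv ({q\<^sub>i} \<union> K\<^sub>0)\<close> and hence \<open>K\<^sub>i\<close>. The measures of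
  the hull depend continuously on \<open>s\<close>, because it contains \<open>p\<close> and scales radially about \<open>p\<close>, and
  because the boundary of a convex set is a null set. The Poincare-Miranda theorem
  gives an \<open>s\<close> with the prescribed measures. For it \<open>s\<^sub>i > 1\<close>, so \<open>H\<^sub>i\<close> separates \<open>v\<^sub>i\<close> from the other
  vertices, and no vertex is lost.
\<close>

section \<open>Pointwise convergence, compact cubes and the Poincare-Miranda theorem\<close>

lemma tendsto_fun_iff:
  fixes X :: "'b \<Rightarrow> 'i \<Rightarrow> 'a::topological_space"
  shows "(X \<longlongrightarrow> l) F \<longleftrightarrow> (\<forall>i. ((\<lambda>k. X k i) \<longlongrightarrow> l i) F)"
proof -
  have "(X \<longlongrightarrow> l) F \<longleftrightarrow> limitin (product_topology (\<lambda>i::'i. euclidean :: 'a topology) UNIV) X l F"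
    by (simp add: euclidean_product_topology)
  also have "\<dots> \<longleftrightarrow> (\<forall>i. ((\<lambda>k. X k i) \<longlongrightarrow> l i) F)"
    by (subst limitin_componentwise) (simp add: topspace_euclidean)
  finally show ?thesis .
qed

lemma compact_Pi_UNIV:
  fixes S :: "'i \<Rightarrow> 'a::topological_space set"
  assumes "\<And>i. compact (S i)"
  shows "compact (Pi UNIV S)"
proof -
  have "compactin (product_topology (\<lambda>i::'i. euclidean :: 'a topology) UNIV) (PiE UNIV S)"
    by (subst compactin_PiE) (simp add: assms)
  then show ?thesis
    by (simp add: euclidean_product_topology PiE_UNIV_domain)
qed

text \<open>Kuhn's combinatorial lemma is used directly because the library's Brouwer theorem lives on
  Euclidean types, while here the dimension is a term.\<close>

theorem poincare_miranda:
  fixes f :: "(nat \<Rightarrow> real) \<Rightarrow> nat \<Rightarrow> real" and n :: nat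
  defines "Q \<equiv> Pi UNIV (\<lambda>_. {0..1})"
  assumes cont: "\<And>i. i < n \<Longrightarrow> continuous_on Q (\<lambda>x. f x i)"
    and lower: "\<And>x i. x \<in> Q \<Longrightarrow> i < n \<Longrightarrow> x i = 0 \<Longrightarrow> f x i \<le> 0"
    and upper: "\<And>x i. x \<in> Q \<Longrightarrow> i < n \<Longrightarrow> x i = 1 \<Longrightarrow> 0 \<le> f x i"
  obtains x where "x \<in> Q" and "\<And>i. i < n \<Longrightarrow> f x i = 0"
proof -
  \<comment> \<open>Lattice points are scaled to mesh \<open>1 / Suc m\<close>. The cap
    \<open>min 1\<close> and the value 0 at indices from \<open>n\<close> on put
    \<open>grid m x\<close> into \<open>Q\<close> for every \<open>x\<close>, with no range
    condition.\<close>
  define grid :: "nat \<Rightarrow> (nat \<Rightarrow> nat) \<Rightarrow> nat \<Rightarrow> real"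
    where "grid m x = (\<lambda>j. if j < n then min 1 (real (x j) / real (Suc m)) else 0)" for m x
  have grid_Q: "grid m x \<in> Q" for m x
    by (auto simp: grid_def Q_def)
  define near where "near m q r \<longleftrightarrow> (\<forall>j. \<bar>grid m r j - grid m q j\<bar> \<le> 1 / Suc m)" for m q r
  have ex: "\<exists>q. \<forall>i<n. (\<exists>r. near m q r \<and> f (grid m r) i \<le> 0) \<and> (\<exists>s. near m q s \<and> 0 \<le> f (grid m s) i)" for m
  proof -
    \<comment> \<open>The labels record the sign of \<open>f\<close>, but on opposite faces they are
      forced to be 0 and 1, as Kuhn's lemma demands. There \<open>label0\<close> and
      \<open>label1\<close> follow from \<open>lower\<close> and \<open>upper\<close>, since only
      weak inequalities are claimed.\<close>
    define label :: "(nat \<Rightarrow> nat) \<Rightarrow> nat \<Rightarrow> nat" where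
      "label x i = (if x i = 0 then 0 else if x i = Suc m then 1 else if f (grid m x) i \<le> 0 then 0 else 1)" for x i
    have label0: "f (grid m x) i \<le> 0" if "label x i = 0" "i < n" for x i
    proof (cases "x i = 0")
      case True
      then show ?thesis using that by (intro lower grid_Q) (auto simp: grid_def)
    qed (use that in \<open>auto simp: label_def split: if_splits\<close>)
    have label1: "0 \<le> f (grid m x) i" if "label x i \<noteq> 0" "i < n" for x i
    proof (cases "x i = Suc m")
      case True
      then show ?thesis using that by (intro upper grid_Q) (auto simp: grid_def)
    qed (use that in \<open>auto simp: label_def split: if_splits\<close>)
    have label01: "label x i = 0 \<or> label x i = 1" for x i
      by (auto simp: label_def)
    have label_ends: "x i = 0 \<Longrightarrow> label x i = 0" "x i = Suc m \<Longrightarrow> label x i = 1" for x i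
      by (auto simp: label_def)
    \<comment> \<open>For each \<open>i < n\<close> the unit cell at \<open>q\<close> has two points
      with different \<open>i\<close>-th labels, so \<open>f\<close> takes both weak signs in
      coordinate \<open>i\<close> within one mesh width.\<close>
    obtain q where q: "\<forall>i<n. \<exists>r s. (\<forall>j<n. q j \<le> r j \<and> r j \<le> q j + 1)
        \<and> (\<forall>j<n. q j \<le> s j \<and> s j \<le> q j + 1) \<and> label r i \<noteq> label s i"
      using label01 label_ends by (rule_tac kuhn_lemma[of "Suc m" n label]) auto
    have near: "near m q r" if "\<forall>j<n. q j \<le> r j \<and> r j \<le> q j + 1" for r
      unfolding near_def
    proof
      fix j
      show "\<bar>grid m r j - grid m q j\<bar> \<le> 1 / Suc m"
      proof (cases "j < n")
        case True
        have "real (q j) / Suc m \<le> real (r j) / Suc m"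
          using that True by (intro divide_right_mono) auto
        moreover have "real (r j) / Suc m \<le> real (q j + 1) / Suc m"
          using that True by (intro divide_right_mono) (auto simp del: of_nat_Suc of_nat_add)
        \<comment> \<open>Capping at 1 is nonexpansive, so the bound for the quotients passes to
          \<open>grid\<close>.\<close>
        moreover have "B \<le> A \<Longrightarrow> A \<le> B + e \<Longrightarrow> \<bar>min 1 A - min 1 B\<bar> \<le> e" for A B e :: real
          by (auto simp: min_def)
        ultimately show ?thesis
          using True by (simp add: grid_def add_divide_distrib add.commute)
      qed (simp add: grid_def)
    qed
    have "(\<exists>r. near m q r \<and> f (grid m r) i \<le> 0) \<and> (\<exists>s. near m q s \<and> 0 \<le> f (grid m s) i)"
      if i: "i < n" for i
    proof -
      obtain r s where rs: "\<forall>j<n. q j \<le> r j \<and> r j \<le> q j + 1" "\<forall>j<n. q j \<le> s j \<and> s j \<le> q j + 1"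
        "label r i \<noteq> label s i" using q i by blast
      show ?thesis
      proof (cases "label r i = 0")
        case True
        then have "label s i \<noteq> 0" using rs(3) by simp
        then show ?thesis using True near[OF rs(1)] near[OF rs(2)] label0 label1 i by blast
      next
        case False
        then have "label s i = 0" using rs(3) label01[of r i] label01[of s i] by auto
        then show ?thesis using False near[OF rs(1)] near[OF rs(2)] label0 label1 i by blast
      qed
    qed
    then show ?thesis by blast
  qed
  from choice[OF allI[where P = "\<lambda>m. \<exists>q. \<forall>i<n. (\<exists>r. near m q r \<and> f (grid m r) i \<le> 0)
      \<and> (\<exists>s. near m q s \<and> 0 \<le> f (grid m s) i)", OF ex]]
  obtain q where q: "\<forall>m. \<forall>i<n. (\<exists>r. near m (q m) r \<and> f (grid m r) i \<le> 0)
      \<and> (\<exists>s. near m (q m) s \<and> 0 \<le> f (grid m s) i)"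
    by (elim exE)
  \<comment> \<open>The index type is countable, so the function space is metric and compactness
    yields a convergent subsequence of the cells.\<close>
  have "compact Q"
    unfolding Q_def by (rule compact_Pi_UNIV) simp
  then obtain x h where x: "x \<in> Q" and h: "strict_mono (h :: nat \<Rightarrow> nat)"
    and lim: "((\<lambda>m. grid m (q m)) \<circ> h) \<longlonglongrightarrow> x"
    unfolding compact_def using grid_Q by meson
  have small: "(\<lambda>k. 1 / real (Suc (h k))) \<longlonglongrightarrow> 0"
    using LIMSEQ_subseq_LIMSEQ[OF LIMSEQ_Suc[OF lim_1_over_n] h] by (simp add: o_def)
  \<comment> \<open>Points near the cells have the same limit \<open>x\<close>, because the mesh
    tends to 0. Hence \<open>f x i\<close> will be a limit of nonpositive values and also of
    nonnegative ones.\<close>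
  have close: "(\<lambda>k. grid (h k) (t (h k))) \<longlonglongrightarrow> x"
    if t: "\<And>m. near m (q m) (t m)" for t
    unfolding tendsto_fun_iff
  proof
    fix j
    have 1: "(\<lambda>k. grid (h k) (t (h k)) j - grid (h k) (q (h k)) j) \<longlonglongrightarrow> 0"
      by (rule tendsto_rabs_zero_cancel, rule tendsto_sandwich[OF _ _ tendsto_const small])
        (use t in \<open>auto simp: near_def\<close>)
    have 2: "(\<lambda>k. grid (h k) (q (h k)) j) \<longlonglongrightarrow> x j"
      using lim by (simp add: tendsto_fun_iff o_def)
    show "(\<lambda>k. grid (h k) (t (h k)) j) \<longlonglongrightarrow> x j"
      using tendsto_add[OF 1 2] by simp
  qed
  have "f x i = 0" if i: "i < n" for i
  proof (rule antisym)
    define r where "r m = (SOME r. near m (q m) r \<and> f (grid m r) i \<le> 0)" for m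
    have "\<exists>r. near m (q m) r \<and> f (grid m r) i \<le> 0" for m
      using q i by blast
    from someI_ex[OF this] have "near m (q m) (r m) \<and> f (grid m (r m)) i \<le> 0" for m
      unfolding r_def .
    then have r: "near m (q m) (r m)" "f (grid m (r m)) i \<le> 0" for m by blast+
    define s where "s m = (SOME s. near m (q m) s \<and> 0 \<le> f (grid m s) i)" for m
    have "\<exists>s. near m (q m) s \<and> 0 \<le> f (grid m s) i" for m
      using q i by blast
    from someI_ex[OF this] have "near m (q m) (s m) \<and> 0 \<le> f (grid m (s m)) i" for m
      unfolding s_def .
    then have s: "near m (q m) (s m)" "0 \<le> f (grid m (s m)) i" for m by blast+
    have conv: "(\<lambda>k. f (grid (h k) (t (h k))) i) \<longlonglongrightarrow> f x i"
      if "(\<lambda>k. grid (h k) (t (h k))) \<longlonglongrightarrow> x" for t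
      using continuous_on_tendsto_compose[OF cont[OF i] that x] grid_Q by simp
    show "f x i \<le> 0"
      using conv[OF close[OF r(1)]] r(2) by (intro LIMSEQ_le_const2) auto
    show "0 \<le> f x i"
      using conv[OF close[OF s(1)]] s(2) by (intro LIMSEQ_le_const) auto
  qed
  with x that show ?thesis by blast
qed

section \<open>Convex hulls of points moving on rays from a centre\<close>

definition radial_hull :: "'a::euclidean_space \<Rightarrow> ('i \<Rightarrow> 'a) \<Rightarrow> 'i set \<Rightarrow> ('i \<Rightarrow> real) \<Rightarrow> 'a set" where
  "radial_hull p u I s = convex hull ((\<lambda>j. p + s j *\<^sub>R u j) ` I)"

lemma convex_radial_hull: "convex (radial_hull p u I s)"
  by (simp add: radial_hull_def)

lemma compact_radial_hull: "finite I \<Longrightarrow> compact (radial_hull p u I s)"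
  by (simp add: radial_hull_def compact_convex_hull finite_imp_compact)

lemma closed_radial_hull: "finite I \<Longrightarrow> closed (radial_hull p u I s)"
  by (simp add: compact_radial_hull compact_imp_closed)

text \<open>A hyperplane strictly separating \<open>p\<close> from one hull forces
  \<open>a \<bullet> u j > 0\<close> for all \<open>j\<close>. This condition does not involve the
  positive factors, so \<open>p\<close> would be separated from the other hull as well.\<close>

lemma centre_in_radial_hull:
  assumes "finite I" and p: "p \<in> radial_hull p u I t" and "\<And>j. j \<in> I \<Longrightarrow> 0 < t j"
    and "\<And>j. j \<in> I \<Longrightarrow> 0 < s j"
  shows "p \<in> radial_hull p u I s"
proof (rule ccontr)
  assume "p \<notin> radial_hull p u I s"
  then obtain a b where ab: "a \<bullet> p < b" "\<And>x. x \<in> radial_hull p u I s \<Longrightarrow> b < a \<bullet> x"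
    using separating_hyperplane_closed_point[OF convex_radial_hull closed_radial_hull[OF assms(1)]]
    by metis
  have "p + t j *\<^sub>R u j \<in> {x. a \<bullet> x > a \<bullet> p}" if j: "j \<in> I" for j
  proof -
    have "b < a \<bullet> (p + s j *\<^sub>R u j)"
      using j by (intro ab) (auto simp: radial_hull_def intro: hull_inc)
    with ab(1) have "0 < s j * (a \<bullet> u j)" by (simp add: inner_add_right)
    with assms(4)[OF j] have "0 < a \<bullet> u j" by (simp add: zero_less_mult_iff)
    then show ?thesis using assms(3)[OF j] by (simp add: inner_add_right)
  qed
  then have "radial_hull p u I t \<subseteq> {x. a \<bullet> x > a \<bullet> p}"
    unfolding radial_hull_def by (intro hull_minimal) (auto simp: convex_halfspace_gt)
  with p show False by auto
qed

text \<open>Contracting by \<open>1 / r\<close> about \<open>p\<close> sends each generator of the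
  second hull to a point between \<open>p\<close> and the corresponding generator of the first.
  Convexity extends this to the whole hull. A uniform bound on ratios of factors thus controls the
  hulls.\<close>

lemma radial_hull_scale:
  assumes p: "p \<in> radial_hull p u I s" and "r > 0"
    and "\<And>j. j \<in> I \<Longrightarrow> 0 < s j" and "\<And>j. j \<in> I \<Longrightarrow> 0 \<le> s' j \<and> s' j \<le> r * s j"
    and y: "y \<in> radial_hull p u I s'"
  shows "p + (1 / r) *\<^sub>R (y - p) \<in> radial_hull p u I s"
proof -
  let ?C = "radial_hull p u I s"
  let ?D = "{y. p + (1 / r) *\<^sub>R (y - p) \<in> ?C}"
  have "convex ?D"
  proof (rule convexI, unfold mem_Collect_eq)
    fix x y and v w :: real
    assume xy: "p + (1 / r) *\<^sub>R (x - p) \<in> ?C" "p + (1 / r) *\<^sub>R (y - p) \<in> ?C" and vw: "0 \<le> v" "0 \<le> w" "v + w = 1"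
    have w: "w = 1 - v" using vw by simp
    have "v *\<^sub>R (p + (1 / r) *\<^sub>R (x - p)) + w *\<^sub>R (p + (1 / r) *\<^sub>R (y - p)) \<in> ?C"
      using convexD[OF convex_radial_hull xy vw] .
    moreover have "v *\<^sub>R (p + (1 / r) *\<^sub>R (x - p)) + w *\<^sub>R (p + (1 / r) *\<^sub>R (y - p))
        = p + (1 / r) *\<^sub>R (v *\<^sub>R x + w *\<^sub>R y - p)"
    proof -
      have "v *\<^sub>R (p + c *\<^sub>R (x - p)) + w *\<^sub>R (p + c *\<^sub>R (y - p)) = p + c *\<^sub>R (v *\<^sub>R x + w *\<^sub>R y - p)" for c
        unfolding w by (simp add: algebra_simps)
      then show ?thesis .
    qed
    ultimately show "p + (1 / r) *\<^sub>R (v *\<^sub>R x + w *\<^sub>R y - p) \<in> ?C" by simp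
  qed
  moreover have "p + s' j *\<^sub>R u j \<in> ?D" if j: "j \<in> I" for j
  proof -
    \<comment> \<open>\<open>c\<close> is the position of the contracted generator on the segment
      from \<open>p\<close> to \<open>p + s j *\<^sub>R u j\<close>.\<close>
    define c where "c = s' j / (r * s j)"
    have c: "0 \<le> c" "c \<le> 1" "c * s j = s' j / r"
      using assms(2) assms(3,4)[OF j] by (auto simp: c_def field_simps)
    have "p + s j *\<^sub>R u j \<in> ?C"
      using j by (auto simp: radial_hull_def intro: hull_inc)
    from convexD[OF convex_radial_hull p this, of "1 - c" c] c
    have "p + (c * s j) *\<^sub>R u j \<in> ?C" by (simp add: algebra_simps)
    then show ?thesis unfolding c by (simp add: divide_inverse_commute)
  qed
  ultimately have "radial_hull p u I s' \<subseteq> ?D"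
    unfolding radial_hull_def[of _ _ _ s'] by (intro hull_minimal) auto
  with y show ?thesis by auto
qed

lemma radial_hull_mono:
  assumes "p \<in> radial_hull p u I s"
    and "\<And>j. j \<in> I \<Longrightarrow> 0 < s j" and "\<And>j. j \<in> I \<Longrightarrow> 0 \<le> s' j \<and> s' j \<le> s j"
  shows "radial_hull p u I s' \<subseteq> radial_hull p u I s"
  using radial_hull_scale[OF assms(1), of 1 s'] assms by auto

section \<open>Null sets and continuity of the measure of a hull\<close>

lemma frontier_convex_null_sets:
  assumes "absolutely_continuous lborel M" and "convex (C :: 'a::euclidean_space set)"
  shows "frontier C \<in> null_sets M"
proof -
  have "frontier C \<in> null_sets lborel"
    using negligible_convex_frontier[OF assms(2)]
    by (simp add: negligible_iff_null_sets null_sets_completion_iff)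
  then show ?thesis using assms(1) by (auto simp: absolutely_continuous_def)
qed

text \<open>The indicators converge at every point off the frontier of the limit hull, which is a
  null set. Dominated convergence applies with the constant 1, integrable because \<open>M\<close>
  is finite.\<close>

lemma tendsto_measure_radial_hull:
  fixes M :: "'a::euclidean_space measure"
  assumes "finite_measure M" and M: "sets M = sets borel" and ac: "absolutely_continuous lborel M"
    and I: "finite I" and p: "p \<in> radial_hull p u I t" and t: "\<And>j. j \<in> I \<Longrightarrow> 0 < t j"
    and s: "\<And>j. j \<in> I \<Longrightarrow> 0 < s j" and X: "\<And>k j. j \<in> I \<Longrightarrow> 0 < X k j"
    and lim: "\<And>j. j \<in> I \<Longrightarrow> (\<lambda>k. X k j) \<longlonglongrightarrow> s j"
  shows "(\<lambda>k. measure M (radial_hull p u I (X k))) \<longlonglongrightarrow> measure M (radial_hull p u I s)"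
proof -
  interpret finite_measure M by fact
  let ?C = "radial_hull p u I"
  have pC: "p \<in> ?C s" "p \<in> ?C (X k)" for k
    using centre_in_radial_hull[OF I p t] s X by auto
  have sets: "?C v \<in> sets M" for v
    unfolding M by (intro borel_closed closed_radial_hull I)
  have ptw: "(\<lambda>k. indicator (?C (X k)) y :: real) \<longlonglongrightarrow> indicator (?C s) y"
    if y: "y \<notin> frontier (?C s)" for y
  proof (cases "y \<in> ?C s")
    case True
    then have int: "y \<in> interior (?C s)" using y closure_subset by (auto simp: frontier_def)
    \<comment> \<open>An interior point stays in the hull when pushed away from \<open>p\<close> by
      some \<open>r > 1\<close>. As soon as \<open>s j < r * X k j\<close> for all \<open>j\<close>,
      contracting back puts \<open>y\<close> into the hull for \<open>X k\<close>.\<close>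
    have "((\<lambda>r. p + r *\<^sub>R (y - p)) \<longlongrightarrow> p + 1 *\<^sub>R (y - p)) (at_right (1::real))"
      by (intro tendsto_intros)
    then have "\<forall>\<^sub>F r in at_right (1::real). p + r *\<^sub>R (y - p) \<in> interior (?C s)"
      using topological_tendstoD[OF _ open_interior[of "?C s"]] int by fastforce
    then have "\<exists>r>1. p + r *\<^sub>R (y - p) \<in> interior (?C s)"
      using eventually_happens'[OF trivial_limit_at_right_real, OF eventually_conj[OF _ eventually_at_right_less]]
      by blast
    then obtain r where r: "r > 1" "p + r *\<^sub>R (y - p) \<in> ?C s"
      using interior_subset by blast
    have "\<forall>\<^sub>F k in sequentially. s j < r * X k j" if "j \<in> I" for j
      using s[OF that] r by (intro order_tendstoD(1)[OF tendsto_mult_left[OF lim[OF that]]]) auto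
    then have "\<forall>\<^sub>F k in sequentially. \<forall>j\<in>I. s j < r * X k j"
      using I by (intro eventually_ball_finite) auto
    then have "\<forall>\<^sub>F k in sequentially. y \<in> ?C (X k)"
    proof eventually_elim
      case (elim k)
      have "p + (1 / r) *\<^sub>R ((p + r *\<^sub>R (y - p)) - p) \<in> ?C (X k)"
        using r elim s X by (intro radial_hull_scale[OF pC(2) _ _ _ r(2)]) (auto simp: less_imp_le)
      then show ?case using r by simp
    qed
    then have "\<forall>\<^sub>F k in sequentially. indicator (?C (X k)) y = (indicator (?C s) y :: real)"
      by eventually_elim (use True in auto)
    then show ?thesis by (rule tendsto_eventually)
  next
    case False
    \<comment> \<open>Dually, a point outside the closed hull stays outside when drawn slightly
      towards \<open>p\<close>. If \<open>X k j < r * s j\<close> for all \<open>j\<close>,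
      membership of \<open>y\<close> in the hull for \<open>X k\<close> would contradict
      this.\<close>
    have "((\<lambda>r. p + (1 / r) *\<^sub>R (y - p)) \<longlongrightarrow> p + (1 / 1) *\<^sub>R (y - p)) (at_right (1::real))"
      by (intro tendsto_intros) auto
    then have "\<forall>\<^sub>F r in at_right (1::real). p + (1 / r) *\<^sub>R (y - p) \<in> - ?C s"
      using topological_tendstoD[OF _ open_Compl[OF closed_radial_hull[OF I]]] False by fastforce
    then have "\<exists>r>1. p + (1 / r) *\<^sub>R (y - p) \<in> - ?C s"
      using eventually_happens'[OF trivial_limit_at_right_real, OF eventually_conj[OF _ eventually_at_right_less]]
      by blast
    then obtain r where r: "r > 1" "p + (1 / r) *\<^sub>R (y - p) \<notin> ?C s"
      by blast
    have "\<forall>\<^sub>F k in sequentially. X k j < r * s j" if "j \<in> I" for j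
      using s[OF that] r by (intro order_tendstoD(2)[OF lim[OF that]]) auto
    then have "\<forall>\<^sub>F k in sequentially. \<forall>j\<in>I. X k j < r * s j"
      using I by (intro eventually_ball_finite) auto
    then have "\<forall>\<^sub>F k in sequentially. y \<notin> ?C (X k)"
    proof eventually_elim
      case (elim k)
      show ?case
      proof
        assume y: "y \<in> ?C (X k)"
        have "p + (1 / r) *\<^sub>R (y - p) \<in> ?C s"
          using r elim s X by (intro radial_hull_scale[OF pC(1) _ _ _ y]) (auto simp: less_imp_le)
        with r show False by simp
      qed
    qed
    then have "\<forall>\<^sub>F k in sequentially. indicator (?C (X k)) y = (indicator (?C s) y :: real)"
      by eventually_elim (use False in auto)
    then show ?thesis by (rule tendsto_eventually)
  qed
  have "AE y in M. y \<notin> frontier (?C s)"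
    using frontier_convex_null_sets[OF ac convex_radial_hull] by (rule AE_not_in)
  then have "AE y in M. (\<lambda>k. indicator (?C (X k)) y :: real) \<longlonglongrightarrow> indicator (?C s) y"
    by eventually_elim (rule ptw)
  then have "(\<lambda>k. \<integral>y. indicator (?C (X k)) y \<partial>M) \<longlonglongrightarrow> (\<integral>y. indicator (?C s) y \<partial>M :: real)"
    by (intro integral_dominated_convergence[where w = "\<lambda>_. 1"] borel_measurable_indicator sets)
      (auto simp: indicator_def)
  moreover have "space M = UNIV" using sets_eq_imp_space_eq[OF M] by simp
  ultimately show ?thesis using sets by simp
qed

text \<open>Each point off the support has a null basic neighbourhood, and a countable basis leaves
  only countably many of these to unite.\<close>

lemma null_sets_Compl_msupport:
  fixes M :: "'a::second_countable_topology measure"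
  assumes M: "sets M = sets borel"
  shows "- msupport M \<in> null_sets M"
proof -
  obtain B :: "'a set set" where B: "countable B" "topological_basis B"
    using ex_countable_basis by blast
  let ?N = "{U \<in> B. emeasure M U = 0}"
  have op: "open U" if "U \<in> B" for U using B(2) that by (rule topological_basis_open)
  have "- msupport M = \<Union> ?N"
  proof (intro subset_antisym subsetI)
    fix x assume "x \<in> - msupport M"
    then obtain U where U: "open U" "x \<in> U" "emeasure M U = 0"
      by (auto simp: msupport_def not_gr_zero)
    then obtain V where V: "V \<in> B" "x \<in> V" "V \<subseteq> U"
      using topological_basisE[OF B(2)] by metis
    have "emeasure M V \<le> emeasure M U"
      using U V by (intro emeasure_mono) (auto simp: M)
    with U V show "x \<in> \<Union> ?N" by auto
  qed (use op in \<open>force simp: msupport_def\<close>)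
  moreover have "(\<Union>U\<in>?N. U) \<in> null_sets M"
    using B(1) op by (intro null_sets_UN') (auto intro!: null_setsI simp: M)
  ultimately show ?thesis by simp
qed

text \<open>The half-space \<open>b i \<le> a i \<bullet> x\<close> contains the hull of the other
  points but not \<open>v i\<close>. So the points are distinct and convexly independent, which
  makes all of them extreme.\<close>

lemma vertices_convex_hull_separated:
  fixes v :: "'i \<Rightarrow> 'a::euclidean_space"
  assumes "finite I" and less: "\<And>i. i \<in> I \<Longrightarrow> a i \<bullet> v i < b i"
    and le: "\<And>i j. i \<in> I \<Longrightarrow> j \<in> I \<Longrightarrow> j \<noteq> i \<Longrightarrow> b i \<le> a i \<bullet> v j"
  shows "vertices (convex hull (v ` I)) = v ` I" and "card (v ` I) = card I"
proof -
  have "v i \<notin> convex hull (v ` I - {v i})" if i: "i \<in> I" for i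
  proof
    assume "v i \<in> convex hull (v ` I - {v i})"
    moreover have "convex hull (v ` I - {v i}) \<subseteq> {x. b i \<le> a i \<bullet> x}"
      using le[OF i] by (intro hull_minimal) (auto simp: convex_halfspace_ge)
    ultimately show False using less[OF i] by auto
  qed
  then show "vertices (convex hull (v ` I)) = v ` I"
    unfolding vertices_def using assms(1)
    by (subst extreme_point_of_convex_hull_convex_independent) (auto intro: finite_imp_compact)
  have "inj_on v I"
    using less le by (intro inj_onI) (metis not_less)
  then show "card (v ` I) = card I" by (rule card_image)
qed

theorem theorem5p3:
  fixes n :: nat
    and \<mu> :: "nat \<Rightarrow> (real ^ 'd::finite) measure"
    and \<alpha> :: "nat \<Rightarrow> real"
  assumes "n \<ge> 1"
    and "\<And>i. i \<in> {1..n} \<Longrightarrow> finite_measure (\<mu> i)"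
    and "\<And>i. i \<in> {1..n} \<Longrightarrow> abs_cont_measure (\<mu> i)"
    and "nicely_separated n \<mu>"
    and "concentrated n \<mu>"
    and "\<And>i. i \<in> {1..n} \<Longrightarrow> 0 < \<alpha> i \<and> \<alpha> i < 1"
  shows "\<exists>K :: (real ^ 'd) set. polytope K \<and> finite (vertices K) \<and> card (vertices K) = n \<and>
           (\<forall>i\<in>{1..n}. measure (\<mu> i) K = \<alpha> i * measure (\<mu> i) UNIV)"
proof -

  \<comment> \<open>Position of the rays relative to the hyperplanes\<close>
  obtain a b where sep: "separating_hyperplanes n \<mu> a b" and conc: "concentrated_wrt n \<mu> a b"
    using assms(5) by (auto simp: concentrated_def)
  define I where "I = {1..n}"
  have I: "finite I" by (simp add: I_def)
  obtain p pt q where p: "p \<in> convex hull (pt ` I)"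
    and p_P: "p \<in> (\<Inter>i\<in>I. hplus (a i) (b i))"
    and pt_P: "\<forall>i\<in>I. pt i \<in> hplane (a i) (b i) \<inter> (\<Inter>i\<in>I. hplus (a i) (b i))"
    and q_P: "\<forall>i\<in>I. q i \<in> ray p (pt i) \<inter> (\<Inter>j\<in>I - {i}. hplus (a j) (b j))"
    and supp: "\<forall>i\<in>I. msupport (\<mu> i) \<subseteq> convex hull ({q i} \<union> convex hull (pt ` I))"
    using conc unfolding concentrated_wrt_def Let_def I_def[symmetric] by (elim bexE exE conjE)
  have p_half: "b i \<le> a i \<bullet> p" if "i \<in> I" for i
    using p_P that by (auto simp: hplus_def)
  have pt: "a i \<bullet> pt i = b i" if "i \<in> I" for i
    using pt_P that by (auto simp: hplane_def)
  have pt_half: "b i \<le> a i \<bullet> pt j" if "i \<in> I" "j \<in> I" for i j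
    using pt_P that by (auto simp: hplus_def)
  have q_half: "b i \<le> a i \<bullet> q j" if "i \<in> I" "j \<in> I" "j \<noteq> i" for i j
    using q_P that by (auto simp: hplus_def)
  have supp_hull: "msupport (\<mu> i) \<subseteq> convex hull ({q i} \<union> convex hull (pt ` I))" if "i \<in> I" for i
    using supp that by blast
  have supp_less: "a i \<bullet> x < b i" if "i \<in> I" "x \<in> msupport (\<mu> i)" for i x
    using sep that unfolding separating_hyperplanes_def I_def hplus_def by force
  have fin: "finite_measure (\<mu> i)" and borel: "sets (\<mu> i) = sets borel"
    and ac: "absolutely_continuous lborel (\<mu> i)" and supp_ne: "msupport (\<mu> i) \<noteq> {}"
    if "i \<in> I" for i
    using assms(2,3)[of i] that by (auto simp: abs_cont_measure_def I_def)
  define u where "u i = pt i - p" for i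
  have "\<exists>c. q i = p + c *\<^sub>R u i" if "i \<in> I" for i
    using q_P that unfolding ray_def u_def by blast
  \<comment> \<open>\<open>t i\<close> is the parameter of \<open>q i\<close> on its ray, normalised
    so that \<open>pt i\<close> has parameter 1.\<close>
  then obtain t where t: "\<And>i. i \<in> I \<Longrightarrow> q i = p + t i *\<^sub>R u i"
    by metis
  have pt_u: "pt i = p + 1 *\<^sub>R u i" for i by (simp add: u_def)
  define C where "C = radial_hull p u I"
  have K0: "convex hull (pt ` I) = C (\<lambda>_. 1)"
    by (simp add: C_def radial_hull_def u_def)
  have C_closed: "closed (C s)" and C_convex: "convex (C s)" for s
    by (simp_all add: C_def closed_radial_hull convex_radial_hull I)
  have mem_C: "p + s j *\<^sub>R u j \<in> C s" if "j \<in> I" for s j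
    using that unfolding C_def radial_hull_def by (intro hull_inc) auto
  have p_C: "p \<in> C s" if "\<And>j. j \<in> I \<Longrightarrow> 0 < s j" for s
    using p that unfolding K0 unfolding C_def
    by (rule_tac centre_in_radial_hull[OF I, where t = "\<lambda>_. 1"]) auto
  \<comment> \<open>Otherwise \<open>q i\<close> and all of the \<open>pt j\<close> would lie in the
    closed positive half-space, and so would the nonempty support, which lies strictly on the other
    side.\<close>
  have q_less: "a i \<bullet> q i < b i" if i: "i \<in> I" for i
  proof (rule ccontr)
    assume "\<not> a i \<bullet> q i < b i"
    then have "convex hull ({q i} \<union> convex hull (pt ` I)) \<subseteq> {x. b i \<le> a i \<bullet> x}"
      using pt_half[OF i] hull_minimal[of "pt ` I" "{x. b i \<le> a i \<bullet> x}" convex]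
      by (intro hull_minimal) (auto simp: convex_halfspace_ge)
    with supp_ne[OF i] supp_less[OF i] supp_hull[OF i] show False by fastforce
  qed
  have au: "a i \<bullet> u i \<le> 0" if "i \<in> I" for i
    using p_half[OF that] pt[OF that] by (simp add: u_def inner_diff_right)
  have beyond: "a i \<bullet> (p + s *\<^sub>R u i) < b i" if i: "i \<in> I" and "1 < s" for i s
  proof -
    \<comment> \<open>If it vanished, \<open>q i\<close> would lie on the hyperplane. With
      \<open>au\<close> the inner product is negative, so passing \<open>pt i\<close> crosses the
      hyperplane strictly.\<close>
    have "a i \<bullet> u i \<noteq> 0"
      using q_less[OF i] t[OF i] pt[OF i] by (auto simp: inner_add_right pt_u)
    then have "(s - 1) * (a i \<bullet> u i) < 0"
      using au[OF i] \<open>1 < s\<close> by (intro mult_pos_neg) auto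
    then show ?thesis using pt[OF i] by (simp add: pt_u inner_add_right algebra_simps)
  qed
  have t1: "1 < t i" if i: "i \<in> I" for i
  proof (rule ccontr)
    assume "\<not> 1 < t i"
    then have "(1 - t i) * (a i \<bullet> u i) \<le> 0"
      using au[OF i] by (intro mult_nonneg_nonpos) auto
    with q_less[OF i] pt[OF i] show False
      by (simp add: t[OF i] pt_u inner_add_right algebra_simps)
  qed
  \<comment> \<open>The point lies between \<open>pt j\<close> and \<open>q j\<close>, both in the
    positive half-space. The sign of \<open>a i \<bullet> u j\<close> decides which endpoint gives
    the bound.\<close>
  have half: "b i \<le> a i \<bullet> (p + s *\<^sub>R u j)"
    if ij: "i \<in> I" "j \<in> I" "j \<noteq> i" and s: "1 \<le> s" "s \<le> t j" for i j s
  proof (cases "0 \<le> a i \<bullet> u j")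
    case True
    then have "1 * (a i \<bullet> u j) \<le> s * (a i \<bullet> u j)" using s by (intro mult_right_mono) auto
    with pt_half[OF ij(1,2)] show ?thesis by (simp add: pt_u inner_add_right)
  next
    case False
    then have "t j * (a i \<bullet> u j) \<le> s * (a i \<bullet> u j)" using s by (intro mult_right_mono_neg) auto
    with q_half[OF ij] show ?thesis by (simp add: t[OF ij(2)] inner_add_right)
  qed

  \<comment> \<open>Measures of the hull at the two ends of a parameter range\<close>
  have null: "- msupport (\<mu> i) \<in> null_sets (\<mu> i)" if "i \<in> I" for i
    using null_sets_Compl_msupport[OF borel[OF that]] .
  have meas_C: "C s \<in> sets (\<mu> i)" if "i \<in> I" for s i
    unfolding borel[OF that] by (intro borel_closed C_closed)
  have total_pos: "0 < measure (\<mu> i) UNIV" if "i \<in> I" for i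
  proof -
    interpret finite_measure "\<mu> i" by (rule fin[OF that])
    have "0 < emeasure (\<mu> i) UNIV"
      using supp_ne[OF that] unfolding msupport_def by blast
    then show ?thesis by (simp add: emeasure_eq_measure)
  qed
  have empty: "measure (\<mu> i) (C s) = 0"
    if i: "i \<in> I" and s: "\<And>j. j \<in> I \<Longrightarrow> 1 \<le> s j \<and> s j \<le> t j" and "s i = 1" for i s
  proof -
    have "b i \<le> a i \<bullet> (p + s j *\<^sub>R u j)" if "j \<in> I" for j
      using half[OF i that] s[OF that] pt[OF i] \<open>s i = 1\<close> by (cases "j = i") (auto simp: pt_u)
    then have "C s \<subseteq> {x. b i \<le> a i \<bullet> x}"
      unfolding C_def radial_hull_def by (intro hull_minimal) (auto simp: convex_halfspace_ge)
    then have "C s \<subseteq> - msupport (\<mu> i)" using supp_less[OF i] by fastforce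
    with null[OF i] meas_C[OF i] have "C s \<in> null_sets (\<mu> i)"
      by (metis null_sets_subset)
    then show ?thesis by (rule measure_eq_0_null_sets)
  qed
  have full: "measure (\<mu> i) (C s) = measure (\<mu> i) UNIV"
    if i: "i \<in> I" and s: "\<And>j. j \<in> I \<Longrightarrow> 1 \<le> s j \<and> s j \<le> t j" and "s i = t i" for i s
  proof -
    have "C (\<lambda>_. 1) \<subseteq> C s"
      using s p_C[of s] unfolding C_def by (intro radial_hull_mono) fastforce+
    moreover have "q i \<in> C s" using mem_C[OF i, of s] \<open>s i = t i\<close> t[OF i] by simp
    ultimately have "convex hull ({q i} \<union> convex hull (pt ` I)) \<subseteq> C s"
      unfolding K0 by (intro hull_minimal C_convex) auto
    then have "UNIV - C s \<subseteq> - msupport (\<mu> i)" using supp_hull[OF i] by auto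
    then have "UNIV - C s \<in> null_sets (\<mu> i)"
      using null[OF i] C_closed[of s] by (rule_tac null_sets_subset) (auto simp: borel[OF i] borel_open open_Diff)
    then have "measure (\<mu> i) (UNIV - (UNIV - C s)) = measure (\<mu> i) UNIV"
      by (intro measure_Diff_null_set) (auto simp: borel[OF i])
    then show ?thesis by (simp add: double_diff)
  qed

  \<comment> \<open>Solving for the prescribed measures\<close>
  \<comment> \<open>Coordinate \<open>j - 1\<close> of the cube is mapped affinely onto the range
    from 1 to \<open>t j\<close>. The shift is due to \<open>I\<close> counting from 1 and the cube
    from 0.\<close>
  define s where "s x j = 1 + x (j - 1) * (t j - 1)" for x :: "nat \<Rightarrow> real" and j
  define Q :: "(nat \<Rightarrow> real) set" where "Q = Pi UNIV (\<lambda>_. {0..1})"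
  have s_bounds: "1 \<le> s x j \<and> s x j \<le> t j" if "x \<in> Q" "j \<in> I" for x j
  proof -
    define y where "y = x (j - 1)"
    have "0 \<le> y" "y \<le> 1" using that(1) by (auto simp: y_def Q_def Pi_iff)
    then have "0 \<le> y * (t j - 1)" "y * (t j - 1) \<le> 1 * (t j - 1)"
      using t1[OF that(2)] by (intro mult_nonneg_nonneg mult_right_mono; simp)+
    moreover have "s x j = 1 + y * (t j - 1)" by (simp only: s_def y_def)
    ultimately show ?thesis by auto
  qed
  \<comment> \<open>This is the excess over the prescribed measure. It is \<open>- \<alpha>\<close>
    times the total mass on the face \<open>x k = 0\<close> and \<open>1 - \<alpha>\<close> times it
    on the face \<open>x k = 1\<close>, with \<open>\<alpha>\<close> taken at
    \<open>Suc k\<close>.\<close>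
  define f where "f x k = measure (\<mu> (Suc k)) (C (s x)) - \<alpha> (Suc k) * measure (\<mu> (Suc k)) UNIV"
    for x k
  obtain x where x: "x \<in> Q" and fx: "\<And>k. k < n \<Longrightarrow> f x k = 0"
  proof (rule poincare_miranda[of n f, folded Q_def])
    fix k assume "k < n"
    then have k: "Suc k \<in> I" by (simp add: I_def)
    show "continuous_on Q (\<lambda>x. f x k)"
    proof (rule continuous_on_sequentiallyI)
      fix X x assume X: "\<forall>m. X m \<in> Q" and x: "x \<in> Q" and "X \<longlonglongrightarrow> x"
      then have lim: "(\<lambda>m. X m j) \<longlonglongrightarrow> x j" for j by (simp add: tendsto_fun_iff)
      have pos: "0 < s y j" if "y \<in> Q" "j \<in> I" for y j using s_bounds[OF that] by simp
      have "(\<lambda>m. measure (\<mu> (Suc k)) (C (s (X m)))) \<longlonglongrightarrow> measure (\<mu> (Suc k)) (C (s x))"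
        using p X x pos unfolding K0 unfolding C_def
        by (intro tendsto_measure_radial_hull[OF fin[OF k] borel[OF k] ac[OF k] I, where t = "\<lambda>_. 1"])
          (auto simp: s_def intro!: tendsto_intros lim)
      then show "(\<lambda>m. f (X m) k) \<longlonglongrightarrow> f x k"
        unfolding f_def by (intro tendsto_intros)
    qed
  next
    fix x k assume "x \<in> Q" "k < n" "x k = 0"
    moreover from \<open>k < n\<close> have k: "Suc k \<in> I" by (simp add: I_def)
    ultimately have "measure (\<mu> (Suc k)) (C (s x)) = 0"
      by (intro empty s_bounds) (auto simp: s_def)
    then show "f x k \<le> 0"
      using assms(6)[of "Suc k"] k by (simp add: f_def I_def)
  next
    fix x k assume "x \<in> Q" "k < n" "x k = 1"
    moreover from \<open>k < n\<close> have k: "Suc k \<in> I" by (simp add: I_def)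
    ultimately have "measure (\<mu> (Suc k)) (C (s x)) = measure (\<mu> (Suc k)) UNIV"
      by (intro full s_bounds) (auto simp: s_def)
    then show "0 \<le> f x k"
      using assms(6)[of "Suc k"] k by (simp add: f_def I_def mult_left_le_one_le)
  qed blast
  have meas: "measure (\<mu> i) (C (s x)) = \<alpha> i * measure (\<mu> i) UNIV" if "i \<in> I" for i
    using fx[of "i - 1"] that by (auto simp: f_def I_def)
  \<comment> \<open>At the lower end the measure would be 0, whereas the prescribed value is
    positive.\<close>
  have s1: "1 < s x i" if i: "i \<in> I" for i
  proof (rule ccontr)
    assume "\<not> 1 < s x i"
    with s_bounds[OF x i] have "measure (\<mu> i) (C (s x)) = 0"
      by (intro empty[OF i] s_bounds[OF x]) auto
    with meas[OF i] total_pos[OF i] assms(6)[of i] i show False by (auto simp: I_def)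
  qed

  \<comment> \<open>Counting the vertices\<close>
  define v where "v j = p + s x j *\<^sub>R u j" for j
  have C_v: "C (s x) = convex hull (v ` I)"
    by (simp add: C_def radial_hull_def v_def)
  have v_less: "a i \<bullet> v i < b i" if "i \<in> I" for i
    unfolding v_def by (intro beyond that s1)
  have v_le: "b i \<le> a i \<bullet> v j" if "i \<in> I" "j \<in> I" "j \<noteq> i" for i j
    unfolding v_def using s_bounds[OF x that(2)] by (intro half that) auto
  have vert: "vertices (C (s x)) = v ` I" and card: "card (v ` I) = card I"
    unfolding C_v using vertices_convex_hull_separated[of I a v b, OF I v_less v_le] by blast+
  have "polytope (C (s x))"
    unfolding C_v polytope_def using I by blast
  moreover have "finite (vertices (C (s x)))" "card (vertices (C (s x))) = n"
    using I card by (simp_all add: vert I_def)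
  ultimately show ?thesis using meas unfolding I_def by blast
qed

end
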